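(* Let $d\ge3$ and let $T_d$ be the (infinite) $d$-regular tree, unweighted; it is bipartite. Then $$\|\widetilde\Delta_1\|=d+2\sqrt{d-1}<2d .$$
   Context: $T_d$ is viewed as a $1$-dimensional complex with all vertex and edge weights equal to $1$. A $1$-cochain is a function $f$ on oriented edges with $f([y,x])=-f([x,y])$, with norm $\|f\|^2=\sum_{\{x,y\}\in\mathcal E}|f([x,y])|^2$ (sum over unoriented edges). With $(d^1u)([x,y])=u(y)-u(x)$ and $(\delta^1f)(x)=\sum_{y\sim x}f([y,x])$, the edge Laplacian is $\widetilde\Delta_1=\Delta_1=d^1\delta^1$, a bounded operator on the Hilbert space of $\ell^2$ $1$-cochains; $\|\cdot\|$ is the operator norm. *)

theory Defs
  imports "HOL-Analysis.Analysis"
begin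

text \<open>
  Simple graphs, possibly infinite: a vertex set \<open>V\<close> and a set \<open>E\<close> of two-element subsets of \<open>V\<close>.
  (The predicate \<open>tree\<close> of the AFP entry Graph Theory is based on directed cycles, and does not
  express the notion of an undirected tree.)
\<close>

definition simple_graph :: "'v set \<Rightarrow> 'v set set \<Rightarrow> bool" where
  "simple_graph V E \<longleftrightarrow> (\<forall>e\<in>E. e \<subseteq> V \<and> card e = 2)"

definition neighbours :: "'v set set \<Rightarrow> 'v \<Rightarrow> 'v set" where
  "neighbours E x = {y. {x, y} \<in> E}"

definition oriented_edges :: "'v set set \<Rightarrow> ('v \<times> 'v) set" where
  "oriented_edges E = {(x, y). {x, y} \<in> E}"

definition connected_graph :: "'v set \<Rightarrow> 'v set set \<Rightarrow> bool" where
  "connected_graph V E \<longleftrightarrow> V \<noteq> {} \<and> (\<forall>x\<in>V. \<forall>y\<in>V. (x, y) \<in> (oriented_edges E)\<^sup>*)"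

definition is_cycle :: "'v set set \<Rightarrow> 'v list \<Rightarrow> bool" where
  "is_cycle E xs \<longleftrightarrow> length xs \<ge> 3 \<and> distinct xs \<and>
     (\<forall>i<length xs. {xs ! i, xs ! (Suc i mod length xs)} \<in> E)"

definition tree_graph :: "'v set \<Rightarrow> 'v set set \<Rightarrow> bool" where
  "tree_graph V E \<longleftrightarrow> simple_graph V E \<and> connected_graph V E \<and> (\<nexists>xs. is_cycle E xs)"

definition regular_graph :: "nat \<Rightarrow> 'v set \<Rightarrow> 'v set set \<Rightarrow> bool" where
  "regular_graph d V E \<longleftrightarrow> (\<forall>x\<in>V. finite (neighbours E x) \<and> card (neighbours E x) = d)"

definition bipartite_graph :: "'v set \<Rightarrow> 'v set set \<Rightarrow> bool" where
  "bipartite_graph V E \<longleftrightarrow>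
     (\<exists>A B. A \<union> B = V \<and> A \<inter> B = {} \<and> (\<forall>e\<in>E. \<exists>a\<in>A. \<exists>b\<in>B. e = {a, b}))"

text \<open>
  Cochains. The value \<open>f([x,y])\<close> is written \<open>f (x, y)\<close>; a 1-cochain is extended by \<open>0\<close> to pairs
  that are not oriented edges, so that distinct cochains are distinct functions.
\<close>

definition one_cochain :: "'v set set \<Rightarrow> ('v \<times> 'v \<Rightarrow> 'k::real_normed_field) \<Rightarrow> bool" where
  "one_cochain E f \<longleftrightarrow> (\<forall>x y. f (y, x) = - f (x, y)) \<and> (\<forall>p. p \<notin> oriented_edges E \<longrightarrow> f p = 0)"

text \<open>
  One of the two orientations of an unoriented edge. Which one is chosen is immaterial for the
  norm, since cochains are antisymmetric.
\<close>

definition orientation :: "'v set \<Rightarrow> 'v \<times> 'v" where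
  "orientation e = (SOME p. e = {fst p, snd p})"

definition l2_cochains :: "'v set set \<Rightarrow> ('v \<times> 'v \<Rightarrow> 'k::real_normed_field) set" where
  "l2_cochains E = {f. one_cochain E f \<and> (\<lambda>e. (norm (f (orientation e)))\<^sup>2) summable_on E}"

definition cochain_norm :: "'v set set \<Rightarrow> ('v \<times> 'v \<Rightarrow> 'k::real_normed_field) \<Rightarrow> real" where
  "cochain_norm E f = sqrt (\<Sum>\<^sub>\<infinity>e\<in>E. (norm (f (orientation e)))\<^sup>2)"

definition d1 :: "'v set set \<Rightarrow> ('v \<Rightarrow> 'k::real_normed_field) \<Rightarrow> 'v \<times> 'v \<Rightarrow> 'k" where
  "d1 E u = (\<lambda>(x, y). if (x, y) \<in> oriented_edges E then u y - u x else 0)"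

definition delta1 :: "'v set set \<Rightarrow> ('v \<times> 'v \<Rightarrow> 'k::real_normed_field) \<Rightarrow> 'v \<Rightarrow> 'k" where
  "delta1 E f x = (\<Sum>y\<in>neighbours E x. f (y, x))"

definition edge_laplacian ::
  "'v set set \<Rightarrow> ('v \<times> 'v \<Rightarrow> 'k::real_normed_field) \<Rightarrow> 'v \<times> 'v \<Rightarrow> 'k" where
  "edge_laplacian E f = d1 E (delta1 E f)"

definition bounded_cochain_operator ::
  "'v set set \<Rightarrow> (('v \<times> 'v \<Rightarrow> 'k::real_normed_field) \<Rightarrow> 'v \<times> 'v \<Rightarrow> 'k) \<Rightarrow> bool" where
  "bounded_cochain_operator E T \<longleftrightarrow>
     (\<forall>f\<in>l2_cochains E. T f \<in> l2_cochains E) \<and>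
     (\<forall>f\<in>l2_cochains E. \<forall>g\<in>l2_cochains E. T (\<lambda>p. f p + g p) = (\<lambda>p. T f p + T g p)) \<and>
     (\<forall>c. \<forall>f\<in>l2_cochains E. T (\<lambda>p. c * f p) = (\<lambda>p. c * T f p)) \<and>
     (\<exists>C. \<forall>f\<in>l2_cochains E. cochain_norm E (T f) \<le> C * cochain_norm E f)"

text \<open>
  The analogue of \<open>onorm\<close> on the space of \<open>\<ell>\<^sup>2\<close> cochains. As for \<open>onorm\<close>, the zero cochain
  contributes \<open>0 / 0 = 0\<close>, and the supremum is only meaningful for bounded operators.
\<close>

definition cochain_onorm ::
  "'v set set \<Rightarrow> (('v \<times> 'v \<Rightarrow> 'k::real_normed_field) \<Rightarrow> 'v \<times> 'v \<Rightarrow> 'k) \<Rightarrow> real" where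
  "cochain_onorm E T = (SUP f\<in>l2_cochains E. cochain_norm E (T f) / cochain_norm E f)"

end

theory Submission
  imports Defs "HOL-Real_Asymp.Real_Asymp"
begin

text \<open>
  Fix a root of the tree and let \<open>s = sqrt (d - 1)\<close>. Since there are no cycles, every vertex
  other than the root has exactly one neighbour that is not further from the root, its parent, and
  that neighbour is strictly closer. Hence distance parity is a bipartition, every vertex other
  than the root has \<open>d - 1\<close> children, and edges correspond to non-root vertices by
  \<open>x \<mapsto> {parent x, x}\<close>. A cochain \<open>f\<close> thus becomes the function \<open>x \<mapsto> f (parent x, x)\<close>, and
  \<open>(1 + s)\<^sup>2 = d + 2 s\<close> is the number to be found.

  Upper bound. The operators \<open>d1\<close> and \<open>delta1\<close> both have norm at most \<open>1 + s\<close>. In either case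
  this follows from the weighted inequality \<open>(a + b)\<^sup>2 \<le> (1 + s) a\<^sup>2 + (1 + 1/s) b\<^sup>2\<close>. For \<open>d1\<close>,
  \<open>a\<close> is the value at the lower end of an edge and \<open>b\<close> the value at its parent; for \<open>delta1\<close>, \<open>a\<close>
  is the value on the edge to the parent and \<open>b\<close> the sum over the edges to the children. The
  weight \<open>s\<close> balances the branching: after summation every non-root vertex carries at most
  \<open>(1 + s) + (1 + 1/s) s\<^sup>2 = (1 + s)\<^sup>2\<close> (\<open>coboundary_energy\<close>, \<open>divergence_energy\<close>). Both
  estimates are made on finite sets of vertices, so that no summability question arises before
  the end.

  Lower bound. The radial function \<open>x \<mapsto> (- 1 / s) ^ level x\<close> is a formal eigenvector with
  eigenvalue \<open>(1 + s)\<^sup>2\<close>: the alternating sign makes all terms of \<open>delta1\<close> and of \<open>d1\<close> add up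
  instead of cancelling. It has the same mass \<open>d / s\<^sup>2\<close> on every sphere, hence barely fails to be
  square summable. Truncated to the levels \<open>1, ..., m + 2\<close> it is still an exact eigenvector on the
  \<open>m\<close> levels \<open>2, ..., m + 1\<close>, so the ratio of norms is at least
  \<open>(1 + s)\<^sup>2 sqrt (m / (m + 2))\<close>, which tends to \<open>(1 + s)\<^sup>2\<close>.
\<close>

section \<open>Orientations and a weighted inequality\<close>

lemma norm_cochain_orientation:
  assumes "one_cochain E f"
  shows "norm (f (orientation {a, b})) = norm (f (a, b))"
proof -
  have "{a, b} = {fst (orientation {a, b}), snd (orientation {a, b})}"
    unfolding orientation_def by (rule someI[of _ "(a, b)"]) simp
  then have "orientation {a, b} = (a, b) \<or> orientation {a, b} = (b, a)"
    by (auto simp: doubleton_eq_iff prod_eq_iff)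
  moreover have "f (b, a) = - f (a, b)" using assms unfolding one_cochain_def by blast
  ultimately show ?thesis by auto
qed

lemma weighted_square_sum:
  fixes a b s :: real
  assumes "s > 0"
  shows "(a + b)\<^sup>2 \<le> (1 + s) * a\<^sup>2 + (1 + 1 / s) * b\<^sup>2"
proof -
  have "(1 + s) * a\<^sup>2 + (1 + 1 / s) * b\<^sup>2 - (a + b)\<^sup>2 = (s * a - b)\<^sup>2 / s"
    using assms by (simp add: field_simps power2_eq_square)
  moreover have "(s * a - b)\<^sup>2 / s \<ge> 0" using assms by simp
  ultimately show ?thesis by linarith
qed

section \<open>Cycles from walks\<close>

text \<open>
  Loops are cut out as the walk grows: when it returns to a vertex already visited, it is reset to
  its prefix ending there.
\<close>
lemma distinct_walk:
  assumes "(y, z) \<in> R\<^sup>*"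
  shows "\<exists>xs. xs \<noteq> [] \<and> hd xs = y \<and> last xs = z \<and> distinct xs \<and>
    set xs \<subseteq> insert y (Range R) \<and> successively (\<lambda>a b. (a, b) \<in> R) xs"
  using assms
proof (induction rule: rtrancl_induct)
  case base
  show ?case by (rule exI[of _ "[y]"]) simp
next
  case (step z w)
  then obtain xs where xs: "xs \<noteq> []" "hd xs = y" "last xs = z" "distinct xs"
    "set xs \<subseteq> insert y (Range R)" "successively (\<lambda>a b. (a, b) \<in> R) xs" by blast
  show ?case
  proof (cases "w \<in> set xs")
    case True
    then obtain as bs where split: "xs = as @ w # bs" by (meson split_list)
    have "as @ [w] \<noteq> [] \<and> hd (as @ [w]) = y \<and> last (as @ [w]) = w \<and> distinct (as @ [w]) \<and>
        set (as @ [w]) \<subseteq> insert y (Range R) \<and> successively (\<lambda>a b. (a, b) \<in> R) (as @ [w])"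
      using xs unfolding split by (auto simp: successively_append_iff hd_append)
    then show ?thesis by blast
  next
    case False
    have "xs @ [w] \<noteq> [] \<and> hd (xs @ [w]) = y \<and> last (xs @ [w]) = w \<and> distinct (xs @ [w]) \<and>
        set (xs @ [w]) \<subseteq> insert y (Range R) \<and> successively (\<lambda>a b. (a, b) \<in> R) (xs @ [w])"
      using xs False step.hyps by (auto simp: successively_append_iff)
    then show ?thesis by blast
  qed
qed

text \<open>
  Two neighbours of \<open>x\<close> that can be joined without visiting \<open>x\<close> close up to a cycle through \<open>x\<close>.
  This is the only way in which cycles are produced.
\<close>
lemma cycle_through_vertex:
  assumes "{x, y} \<in> E" "{x, z} \<in> E" "y \<noteq> z" "y \<noteq> x"
    and walk: "(y, z) \<in> {(a, b) \<in> oriented_edges E. a \<noteq> x \<and> b \<noteq> x}\<^sup>*"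
  shows "\<exists>xs. is_cycle E xs"
proof -
  obtain xs where xs: "xs \<noteq> []" "hd xs = y" "last xs = z" "distinct xs"
    "set xs \<subseteq> insert y (Range {(a, b) \<in> oriented_edges E. a \<noteq> x \<and> b \<noteq> x})"
    "successively (\<lambda>a b. (a, b) \<in> {(a, b) \<in> oriented_edges E. a \<noteq> x \<and> b \<noteq> x}) xs"
    using distinct_walk[OF walk] by blast
  have "x \<notin> set xs" using xs(5) \<open>y \<noteq> x\<close> by auto
  have len: "length xs \<ge> 2"
    using xs(1-3) \<open>y \<noteq> z\<close> by (cases xs rule: list.exhaust; cases "tl xs") auto
  have "{(x # xs) ! i, (x # xs) ! (Suc i mod length (x # xs))} \<in> E" if i: "i < length (x # xs)" for i
  proof -
    consider "i = 0" | j where "i = Suc j" "Suc j < length xs" | "i = length xs" "i \<noteq> 0"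
      using i xs(1) by (cases i) (auto simp: less_Suc_eq)
    then show ?thesis
    proof cases
      case 1
      then show ?thesis using xs(1,2) assms(1) len by (simp add: hd_conv_nth)
    next
      case (2 j)
      then have "{xs ! j, xs ! Suc j} \<in> E"
        using xs(6) by (auto simp: successively_conv_nth oriented_edges_def)
      then show ?thesis using 2 by simp
    next
      case 3
      then have "(x # xs) ! i = z" using xs(1,3) by (simp add: last_conv_nth nth_Cons')
      then show ?thesis using 3 assms(2) by (simp add: insert_commute)
    qed
  qed
  then have "is_cycle E (x # xs)"
    using xs(4) len \<open>x \<notin> set xs\<close> unfolding is_cycle_def by auto
  then show ?thesis by blast
qed

section \<open>The tree as a rooted tree\<close>

locale regular_tree =
  fixes d :: nat and V :: "'v set" and E :: "'v set set"
  assumes degree: "d \<ge> 3"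
    and tree: "tree_graph V E"
    and regular: "regular_graph d V E"
begin

definition root :: 'v where
  "root = (SOME r. r \<in> V)"

definition level :: "'v \<Rightarrow> nat" where
  "level x = (LEAST n. (root, x) \<in> oriented_edges E ^^ n)"

definition parent :: "'v \<Rightarrow> 'v" where
  "parent x = (SOME y. {y, x} \<in> E \<and> Suc (level y) = level x)"

definition children :: "'v \<Rightarrow> 'v set" where
  "children x = {y \<in> V - {root}. parent y = x}"

lemma edge_in_V: "{x, y} \<in> E \<Longrightarrow> x \<in> V \<and> y \<in> V \<and> x \<noteq> y"
  using tree unfolding tree_graph_def simple_graph_def by (force simp: card_insert_if)

lemma root_in_V: "root \<in> V"
proof -
  have "\<exists>r. r \<in> V" using tree unfolding tree_graph_def connected_graph_def by blast
  then show ?thesis unfolding root_def by (rule someI_ex)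
qed

lemma walk_of_level:
  assumes "x \<in> V"
  shows "(root, x) \<in> oriented_edges E ^^ level x"
proof -
  have "(root, x) \<in> (oriented_edges E)\<^sup>*"
    using tree assms root_in_V unfolding tree_graph_def connected_graph_def by blast
  then have "\<exists>n. (root, x) \<in> oriented_edges E ^^ n" by (blast dest: rtrancl_imp_relpow)
  then show ?thesis unfolding level_def by (rule LeastI_ex)
qed

lemma level_le: "(root, x) \<in> oriented_edges E ^^ n \<Longrightarrow> level x \<le> n"
  unfolding level_def by (rule Least_le)

lemma level_root [simp]: "level root = 0"
  using level_le[of root 0] by simp

lemma level_pos: "x \<in> V - {root} \<Longrightarrow> 0 < level x"
  using walk_of_level[of x] by (cases "level x") auto

lemma level_step:
  assumes "{x, y} \<in> E"
  shows "level y \<le> Suc (level x)"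
proof (rule level_le)
  have "(root, x) \<in> oriented_edges E ^^ level x" "(x, y) \<in> oriented_edges E"
    using walk_of_level edge_in_V[OF assms] assms by (auto simp: oriented_edges_def)
  then show "(root, y) \<in> oriented_edges E ^^ Suc (level x)" by (rule relpow_Suc_I)
qed

lemma ex_lower_neighbour:
  assumes "x \<in> V - {root}"
  shows "\<exists>y. {y, x} \<in> E \<and> Suc (level y) = level x"
proof -
  obtain n where n: "level x = Suc n" using level_pos[OF assms] by (cases "level x") auto
  then have "(root, x) \<in> oriented_edges E ^^ Suc n" using walk_of_level assms by fastforce
  then obtain y where y: "(root, y) \<in> oriented_edges E ^^ n" "(y, x) \<in> oriented_edges E"
    by (rule relpow_Suc_E)
  then have "{y, x} \<in> E" by (simp add: oriented_edges_def)
  then show ?thesis using level_le[OF y(1)] level_step n by fastforce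
qed

lemma
  assumes "x \<in> V - {root}"
  shows parent_edge: "{parent x, x} \<in> E" and level_parent: "Suc (level (parent x)) = level x"
  using someI_ex[OF ex_lower_neighbour[OF assms]] unfolding parent_def by auto

lemma parent_in_V: "x \<in> V - {root} \<Longrightarrow> parent x \<in> V"
  using parent_edge edge_in_V by blast

text \<open>
  Following parents from \<open>y\<close> to the root, the level drops strictly, so \<open>x\<close> is never met.
\<close>
lemma walk_avoiding:
  assumes "x \<in> V - {root}" "y \<in> V" "y \<noteq> x" "level y \<le> level x"
  shows "(root, y) \<in> {(a, b) \<in> oriented_edges E. a \<noteq> x \<and> b \<noteq> x}\<^sup>*"
  using assms(2-4)
proof (induction "level y" arbitrary: y rule: less_induct)
  case less
  show ?case
  proof (cases "y = root")
    case False
    then have y: "y \<in> V - {root}" using less.prems by auto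
    have lt: "level (parent y) < level y" using level_parent[OF y] by simp
    moreover have "parent y \<noteq> x" using lt less.prems by auto
    ultimately have
      "(root, parent y) \<in> {(a, b) \<in> oriented_edges E. a \<noteq> x \<and> b \<noteq> x}\<^sup>*"
      using less parent_in_V[OF y] by fastforce
    moreover have "(parent y, y) \<in> {(a, b) \<in> oriented_edges E. a \<noteq> x \<and> b \<noteq> x}"
      using parent_edge[OF y] \<open>parent y \<noteq> x\<close> less.prems by (auto simp: oriented_edges_def)
    ultimately show ?thesis by (rule rtrancl_into_rtrancl)
  qed simp
qed

text \<open>
  Otherwise \<open>y\<close> and \<open>parent x\<close> would be two neighbours of \<open>x\<close>, both joined to the root without
  visiting \<open>x\<close>. The hypothesis on levels is not strict, so this also excludes edges between
  vertices of equal level.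
\<close>
lemma lower_neighbour_is_parent:
  assumes x: "x \<in> V - {root}" and y: "{x, y} \<in> E" "level y \<le> level x"
  shows "y = parent x"
proof (rule ccontr)
  assume neq: "y \<noteq> parent x"
  let ?R = "{(a, b) \<in> oriented_edges E. a \<noteq> x \<and> b \<noteq> x}"
  have "sym ?R" by (auto simp: sym_def oriented_edges_def insert_commute)
  have "(root, y) \<in> ?R\<^sup>*" using walk_avoiding[OF x] edge_in_V[OF y(1)] y(2) by auto
  then have "(y, root) \<in> ?R\<^sup>*" using \<open>sym ?R\<close> by (meson sym_rtrancl symD)
  moreover have "(root, parent x) \<in> ?R\<^sup>*"
    using walk_avoiding[OF x] edge_in_V[OF parent_edge[OF x]] level_parent[OF x] by auto
  ultimately have "(y, parent x) \<in> ?R\<^sup>*" by (rule rtrancl_trans)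
  then have "\<exists>xs. is_cycle E xs"
    using cycle_through_vertex[of x y E "parent x"] y(1) parent_edge[OF x] neq edge_in_V[OF y(1)]
    by (auto simp: insert_commute)
  then show False using tree unfolding tree_graph_def by blast
qed

lemma edge_cases:
  assumes "{x, y} \<in> E"
  shows "(y \<in> V - {root} \<and> x = parent y) \<or> (x \<in> V - {root} \<and> y = parent x)"
proof (cases "level y \<le> level x \<and> x \<noteq> root")
  case True
  then show ?thesis using lower_neighbour_is_parent[of x y] edge_in_V[OF assms] assms by auto
next
  case False
  then have "y \<in> V - {root}" "level x \<le> level y" using edge_in_V[OF assms] by auto
  then show ?thesis using lower_neighbour_is_parent[of y x] assms by (auto simp: insert_commute)
qed

lemma bipartite: "bipartite_graph V E"
proof -
  let ?A = "{x \<in> V. even (level x)}" and ?B = "{x \<in> V. odd (level x)}"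
  have "\<exists>a\<in>?A. \<exists>b\<in>?B. e = {a, b}" if "e \<in> E" for e
  proof -
    have "card e = 2" using tree that unfolding tree_graph_def simple_graph_def by blast
    then obtain x y where e: "e = {x, y}" by (auto simp: card_2_iff)
    have ab: "\<exists>a\<in>?A. \<exists>b\<in>?B. {parent x, x} = {a, b}" if x: "x \<in> V - {root}" for x
    proof -
      have "even (level (parent x)) \<noteq> even (level x)" using level_parent[OF x] by presburger
      then show ?thesis
        using parent_in_V[OF x] x by (cases "even (level x)") (auto simp: insert_commute)
    qed
    show ?thesis using edge_cases[of x y] \<open>e \<in> E\<close> ab[of x] ab[of y]
      unfolding e by (auto simp: insert_commute)
  qed
  then show ?thesis unfolding bipartite_graph_def
    by (intro exI[of _ ?A] exI[of _ ?B]) auto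
qed

text \<open>
  All sums over edges are turned into sums over non-root vertices by this bijection.
\<close>
lemma bij_edges: "bij_betw (\<lambda>x. {parent x, x}) (V - {root}) E"
proof (rule bij_betw_imageI)
  show "inj_on (\<lambda>x. {parent x, x}) (V - {root})"
  proof (rule inj_onI)
    fix x y assume x: "x \<in> V - {root}" and y: "y \<in> V - {root}" and "{parent x, x} = {parent y, y}"
    then have "x = y \<or> (x = parent y \<and> y = parent x)" by (auto simp: doubleton_eq_iff)
    then show "x = y" using level_parent[OF x] level_parent[OF y] by auto
  qed
  show "(\<lambda>x. {parent x, x}) ` (V - {root}) = E"
  proof (intro equalityI subsetI)
    fix e assume "e \<in> E"
    then have "card e = 2" using tree unfolding tree_graph_def simple_graph_def by blast
    then obtain x y where "e = {x, y}" by (auto simp: card_2_iff)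
    then show "e \<in> (\<lambda>x. {parent x, x}) ` (V - {root})"
      using edge_cases[of x y] \<open>e \<in> E\<close> by (auto simp: insert_commute)
  qed (use parent_edge in auto)
qed

lemma neighbours_eq:
  assumes "x \<in> V"
  shows "neighbours E x = (if x = root then {} else {parent x}) \<union> children x"
proof -
  have "{x, parent x} \<in> E" if "x \<noteq> root"
    using parent_edge[of x] assms that by (simp add: insert_commute)
  moreover have "{x, y} \<in> E" if "y \<in> children x" for y
    using parent_edge[of y] that by (auto simp: children_def)
  moreover have "y \<in> children x \<or> (x \<noteq> root \<and> y = parent x)" if "{x, y} \<in> E" for y
    using edge_cases[OF that] by (auto simp: children_def)
  ultimately show ?thesis by (auto simp: neighbours_def)
qed

lemma parent_notin_children: "x \<in> V - {root} \<Longrightarrow> parent x \<notin> children x"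
proof
  assume x: "x \<in> V - {root}" and "parent x \<in> children x"
  then have "parent x \<in> V - {root}" "parent (parent x) = x" by (auto simp: children_def)
  then show False using level_parent[OF x] level_parent[of "parent x"] by simp
qed

lemma
  assumes "x \<in> V"
  shows finite_children: "finite (children x)"
    and card_children: "card (children x) = (if x = root then d else d - 1)"
proof -
  have *: "finite (neighbours E x)" "card (neighbours E x) = d"
    using regular assms unfolding regular_graph_def by auto
  then show fin: "finite (children x)" unfolding neighbours_eq[OF assms] by simp
  show "card (children x) = (if x = root then d else d - 1)"
    using *(2) parent_notin_children[of x] assms fin unfolding neighbours_eq[OF assms]
    by (auto split: if_splits)
qed

section \<open>Upper bound\<close>

definition s :: real where
  "s = sqrt (real d - 1)"

abbreviation up :: "('v \<times> 'v \<Rightarrow> 'k::real_normed_field) \<Rightarrow> 'v \<Rightarrow> real" where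
  "up f x \<equiv> (norm (f (parent x, x)))\<^sup>2"

lemma s_gt_1: "s > 1"
  using degree by (simp add: s_def real_less_rsqrt)

lemma s_square: "s\<^sup>2 = real d - 1"
  using degree by (simp add: s_def)

lemma norm_bound_eq: "(1 + s)\<^sup>2 = real d + 2 * s"
  using s_square by (simp add: power2_eq_square algebra_simps)

lemma l2_cochains_iff:
  "f \<in> l2_cochains E \<longleftrightarrow> one_cochain E f \<and> up f summable_on (V - {root})"
  using summable_on_reindex_bij_betw[OF bij_edges, of "\<lambda>e. (norm (f (orientation e)))\<^sup>2"]
  by (auto simp: l2_cochains_def norm_cochain_orientation)

lemma cochain_norm_square:
  assumes "one_cochain E f"
  shows "(cochain_norm E f)\<^sup>2 = (\<Sum>\<^sub>\<infinity>x\<in>V - {root}. up f x)"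
  using infsum_reindex_bij_betw[OF bij_edges, of "\<lambda>e. (norm (f (orientation e)))\<^sup>2"]
  by (simp add: cochain_norm_def norm_cochain_orientation[OF assms] infsum_nonneg)

lemma edge_laplacian_one_cochain: "one_cochain E (edge_laplacian E f)"
  by (auto simp: one_cochain_def edge_laplacian_def d1_def oriented_edges_def insert_commute)

lemma edge_laplacian_parent:
  "x \<in> V - {root} \<Longrightarrow>
    edge_laplacian E f (parent x, x) = delta1 E f x - delta1 E f (parent x)"
  using parent_edge by (simp add: edge_laplacian_def d1_def oriented_edges_def)

lemma delta1_eq:
  assumes "one_cochain E f" "x \<in> V"
  shows "delta1 E f x = (if x = root then 0 else f (parent x, x)) - (\<Sum>y\<in>children x. f (x, y))"
proof -
  have "f (y, x) = - f (x, y)" for y using assms(1) unfolding one_cochain_def by blast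
  then show ?thesis
    using parent_notin_children[of x] assms(2) finite_children[OF assms(2)]
    unfolding delta1_def neighbours_eq[OF assms(2)] by (auto simp: sum_negf)
qed

text \<open>
  A vertex \<open>y\<close> other than the root is counted with weight \<open>1 + s\<close> once, as the lower end of the
  edge to its parent, and with weight \<open>1 + 1 / s\<close> at most \<open>s\<^sup>2\<close> times, as the parent of its
  children. The root has one more child but no parent, and \<open>1 / s \<le> s\<close> makes up for it.
\<close>
lemma coboundary_energy:
  fixes u :: "'v \<Rightarrow> 'k::real_normed_field"
  assumes "finite F" "F \<subseteq> V - {root}"
  shows "(\<Sum>x\<in>F. (norm (u x - u (parent x)))\<^sup>2)
    \<le> (1 + s)\<^sup>2 * (\<Sum>x\<in>F \<union> parent ` F. (norm (u x))\<^sup>2)"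
proof -
  let ?n = "\<lambda>x. (norm (u x))\<^sup>2" and ?G = "F \<union> parent ` F"
  let ?F = "\<lambda>y. {x. x \<in> F \<and> parent x = y}"
  have G: "finite ?G" "?G \<subseteq> V" using assms parent_in_V by auto
  have "(\<Sum>x\<in>F. (norm (u x - u (parent x)))\<^sup>2)
      \<le> (\<Sum>x\<in>F. (1 + s) * ?n x + (1 + 1 / s) * ?n (parent x))"
  proof (rule sum_mono)
    fix x
    have "(norm (u x - u (parent x)))\<^sup>2 \<le> (norm (u x) + norm (u (parent x)))\<^sup>2"
      by (intro power_mono norm_triangle_ineq4) simp
    also have "\<dots> \<le> (1 + s) * ?n x + (1 + 1 / s) * ?n (parent x)"
      using s_gt_1 by (intro weighted_square_sum) simp
    finally show "(norm (u x - u (parent x)))\<^sup>2 \<le> (1 + s) * ?n x + (1 + 1 / s) * ?n (parent x)" .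
  qed
  also have "\<dots> = (\<Sum>x\<in>F. (1 + s) * ?n x) + (1 + 1 / s) * (\<Sum>x\<in>F. ?n (parent x))"
    by (simp add: sum.distrib sum_distrib_left)
  also have "(\<Sum>x\<in>F. ?n (parent x)) = (\<Sum>y\<in>?G. real (card (?F y)) * ?n y)"
    using sum.group[OF assms(1) G(1), of parent "\<lambda>x. ?n (parent x)"] by auto
  also have "(\<Sum>x\<in>F. (1 + s) * ?n x) \<le> (\<Sum>x\<in>?G. (if x = root then 0 else 1 + s) * ?n x)"
  proof -
    have "(\<Sum>x\<in>F. (1 + s) * ?n x) = (\<Sum>x\<in>F. (if x = root then 0 else 1 + s) * ?n x)"
      using assms by (intro sum.cong) auto
    also have "\<dots> \<le> (\<Sum>x\<in>?G. (if x = root then 0 else 1 + s) * ?n x)"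
      using s_gt_1 G by (intro sum_mono2) auto
    finally show ?thesis .
  qed
  also have "(\<Sum>x\<in>?G. (if x = root then 0 else 1 + s) * ?n x)
      + (1 + 1 / s) * (\<Sum>y\<in>?G. real (card (?F y)) * ?n y)
      = (\<Sum>y\<in>?G. ((if y = root then 0 else 1 + s) + (1 + 1 / s) * real (card (?F y))) * ?n y)"
    by (simp add: sum.distrib sum_distrib_left algebra_simps)
  also have "\<dots> \<le> (\<Sum>y\<in>?G. (1 + s)\<^sup>2 * ?n y)"
  proof (intro sum_mono mult_right_mono)
    fix y assume "y \<in> ?G"
    then have y: "y \<in> V" using G by auto
    have "card (?F y) \<le> card (children y)"
      using assms finite_children[OF y] by (intro card_mono) (auto simp: children_def)
    also have "\<dots> = (if y = root then d else d - 1)" by (rule card_children[OF y])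
    finally have "real (card (?F y)) \<le> (if y = root then s\<^sup>2 + 1 else s\<^sup>2)"
      using s_square degree by (auto split: if_splits simp: of_nat_diff)
    then have "(1 + 1 / s) * real (card (?F y)) \<le> (1 + 1 / s) * (if y = root then s\<^sup>2 + 1 else s\<^sup>2)"
      using s_gt_1 by (intro mult_left_mono) auto
    moreover have "(1 + 1 / s) * (s\<^sup>2 + 1) \<le> (1 + s)\<^sup>2" "1 + s + (1 + 1 / s) * s\<^sup>2 = (1 + s)\<^sup>2"
    proof -
      have "1 / s \<le> 1" "1 \<le> s" using s_gt_1 by simp_all
      then have "1 / s \<le> s" by linarith
      moreover have "(1 + 1 / s) * (s\<^sup>2 + 1) = s\<^sup>2 + 1 + s + 1 / s"
        using s_gt_1 by (simp add: field_simps power2_eq_square)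
      ultimately show "(1 + 1 / s) * (s\<^sup>2 + 1) \<le> (1 + s)\<^sup>2" by (simp add: power2_sum)
      show "1 + s + (1 + 1 / s) * s\<^sup>2 = (1 + s)\<^sup>2"
        using s_gt_1 by (simp add: field_simps power2_eq_square)
    qed
    ultimately show "(if y = root then 0 else 1 + s) + (1 + 1 / s) * real (card (?F y)) \<le> (1 + s)\<^sup>2"
      by (auto split: if_splits)
  qed simp
  finally show ?thesis by (simp add: sum_distrib_left)
qed

text \<open>
  The weighted inequality separates the edge to the parent from the edges to the children, and
  Cauchy-Schwarz over the \<open>s\<^sup>2\<close> children gives the factor \<open>(1 + 1 / s) s\<^sup>2 = s\<^sup>2 + s\<close>. At the root
  the first term is absent, and the \<open>d = s\<^sup>2 + 1\<close> children cost no more than \<open>s\<^sup>2 + s\<close>.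
\<close>
lemma divergence_at_vertex:
  fixes f :: "'v \<times> 'v \<Rightarrow> 'k::real_normed_field"
  assumes "one_cochain E f" "x \<in> V"
  shows "(norm (delta1 E f x))\<^sup>2 \<le>
    (if x = root then 0 else (1 + s) * up f x) + (s\<^sup>2 + s) * (\<Sum>y\<in>children x. up f y)"
proof -
  let ?a = "if x = root then 0 else norm (f (parent x, x))"
  let ?b = "\<Sum>y\<in>children x. norm (f (parent y, y))"
  have ch: "(\<Sum>y\<in>children x. f (x, y)) = (\<Sum>y\<in>children x. f (parent y, y))"
    by (rule sum.cong) (auto simp: children_def)
  have "norm (delta1 E f x) \<le> norm (if x = root then 0 else f (parent x, x)) + ?b"
    unfolding delta1_eq[OF assms] ch by (rule norm_triangle_le_diff) (simp add: norm_sum)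
  also have "\<dots> = ?a + ?b" by simp
  finally have le: "(norm (delta1 E f x))\<^sup>2 \<le> (?a + ?b)\<^sup>2" by (intro power_mono) simp_all
  have CS: "?b\<^sup>2 \<le> (\<Sum>y\<in>children x. up f y) * real (card (children x))"
    by (rule sum_squared_le_sum_of_squares)
  have nn: "0 \<le> (\<Sum>y\<in>children x. up f y)" by (simp add: sum_nonneg)
  show ?thesis
  proof (cases "x = root")
    case True
    have "real (card (children x)) \<le> s\<^sup>2 + s"
      using card_children[OF assms(2)] True s_square s_gt_1 by simp
    then have "?b\<^sup>2 \<le> (\<Sum>y\<in>children x. up f y) * (s\<^sup>2 + s)"
      using CS nn by (meson mult_left_mono order_trans)
    then show ?thesis using le True by (simp add: mult.commute)
  next
    case False
    have "real (card (children x)) = s\<^sup>2"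
      using card_children[OF assms(2)] False s_square degree by simp
    then have "(1 + 1 / s) * ?b\<^sup>2 \<le> (1 + 1 / s) * ((\<Sum>y\<in>children x. up f y) * s\<^sup>2)"
      using CS s_gt_1 by (intro mult_left_mono) auto
    also have "\<dots> = (s\<^sup>2 + s) * (\<Sum>y\<in>children x. up f y)"
      using s_gt_1 by (simp add: field_simps power2_eq_square)
    finally show ?thesis
      using le weighted_square_sum[of s ?a ?b] s_gt_1 False by simp
  qed
qed

text \<open>
  Each value \<open>f (parent x, x)\<close> is counted in two divergences, at \<open>x\<close> with factor \<open>1 + s\<close> and at
  \<open>parent x\<close> with factor \<open>s\<^sup>2 + s\<close>; these add up to \<open>(1 + s)\<^sup>2\<close>.
\<close>
lemma divergence_energy:
  fixes f :: "'v \<times> 'v \<Rightarrow> 'k::real_normed_field"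
  assumes "one_cochain E f" "finite F" "F \<subseteq> V"
  shows "(\<Sum>x\<in>F. (norm (delta1 E f x))\<^sup>2)
    \<le> (1 + s)\<^sup>2 * (\<Sum>x\<in>(F - {root}) \<union> (\<Union>x\<in>F. children x). up f x)"
proof -
  let ?C = "\<Union>x\<in>F. children x"
  let ?S = "\<Sum>x\<in>(F - {root}) \<union> ?C. up f x"
  have fin: "finite ?C" using assms finite_children by auto
  have "(\<Sum>x\<in>F. (norm (delta1 E f x))\<^sup>2)
      \<le> (\<Sum>x\<in>F. (if x = root then 0 else (1 + s) * up f x)
            + (s\<^sup>2 + s) * (\<Sum>y\<in>children x. up f y))"
    using assms(3) by (intro sum_mono divergence_at_vertex[OF assms(1)]) blast
  also have "\<dots> = (\<Sum>x\<in>F. if x = root then 0 else (1 + s) * up f x)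
      + (s\<^sup>2 + s) * (\<Sum>x\<in>F. \<Sum>y\<in>children x. up f y)"
    by (simp add: sum.distrib sum_distrib_left)
  also have "(\<Sum>x\<in>F. if x = root then 0 else (1 + s) * up f x) = (1 + s) * (\<Sum>x\<in>F - {root}. up f x)"
    unfolding sum_distrib_left using assms(2) by (intro sum.mono_neutral_cong_right) auto
  also have "(\<Sum>x\<in>F. \<Sum>y\<in>children x. up f y) = (\<Sum>y\<in>?C. up f y)"
    using assms(2,3) finite_children
    by (intro sum.UNION_disjoint[symmetric]) (auto simp: children_def)
  also have "(1 + s) * (\<Sum>x\<in>F - {root}. up f x) + (s\<^sup>2 + s) * (\<Sum>y\<in>?C. up f y)
      \<le> (1 + s) * ?S + (s\<^sup>2 + s) * ?S"
    using s_gt_1 fin assms(2) by (intro add_mono mult_left_mono sum_mono2) auto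
  also have "\<dots> = (1 + s)\<^sup>2 * ?S"
    by (simp add: power2_eq_square algebra_simps)
  finally show ?thesis .
qed

lemma edge_laplacian_energy:
  fixes f :: "'v \<times> 'v \<Rightarrow> 'k::real_normed_field"
  assumes "f \<in> l2_cochains E" "finite F" "F \<subseteq> V - {root}"
  shows "(\<Sum>x\<in>F. up (edge_laplacian E f) x) \<le> ((1 + s)\<^sup>2 * cochain_norm E f)\<^sup>2"
proof -
  let ?G = "F \<union> parent ` F"
  let ?H = "(?G - {root}) \<union> (\<Union>x\<in>?G. children x)"
  have f: "one_cochain E f" "up f summable_on (V - {root})" using assms(1) l2_cochains_iff by auto
  have G: "finite ?G" "?G \<subseteq> V" using assms(2,3) parent_in_V by auto
  have H: "finite ?H" "?H \<subseteq> V - {root}"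
    using G finite_children by (auto simp: children_def)
  have "(\<Sum>x\<in>F. up (edge_laplacian E f) x)
      = (\<Sum>x\<in>F. (norm (delta1 E f x - delta1 E f (parent x)))\<^sup>2)"
    using assms(3) by (intro sum.cong refl) (simp add: edge_laplacian_parent subset_iff)
  also have "\<dots> \<le> (1 + s)\<^sup>2 * (\<Sum>x\<in>?G. (norm (delta1 E f x))\<^sup>2)"
    by (rule coboundary_energy[OF assms(2,3)])
  also have "\<dots> \<le> (1 + s)\<^sup>2 * ((1 + s)\<^sup>2 * (\<Sum>x\<in>?H. up f x))"
    by (intro mult_left_mono divergence_energy[OF f(1) G]) simp
  also have "\<dots> \<le> (1 + s)\<^sup>2 * ((1 + s)\<^sup>2 * (\<Sum>\<^sub>\<infinity>x\<in>V - {root}. up f x))"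
    by (intro mult_left_mono finite_sum_le_infsum[OF f(2) H]) simp_all
  also have "\<dots> = ((1 + s)\<^sup>2 * cochain_norm E f)\<^sup>2"
    by (simp only: cochain_norm_square[OF f(1), symmetric] power_mult_distrib
        power2_eq_square[of "(1 + s)\<^sup>2"] mult.assoc)
  finally show ?thesis .
qed

lemma cochain_norm_nonneg: "0 \<le> cochain_norm E f"
  by (simp add: cochain_norm_def infsum_nonneg)

lemma
  fixes f :: "'v \<times> 'v \<Rightarrow> 'k::real_normed_field"
  assumes "f \<in> l2_cochains E"
  shows edge_laplacian_l2: "edge_laplacian E f \<in> l2_cochains E"
    and edge_laplacian_norm_le: "cochain_norm E (edge_laplacian E f) \<le> (1 + s)\<^sup>2 * cochain_norm E f"
proof -
  have summable: "up (edge_laplacian E f) summable_on (V - {root})"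
    using edge_laplacian_energy[OF assms]
    by (intro nonneg_bdd_above_summable_on bdd_aboveI2[where M = "((1 + s)\<^sup>2 * cochain_norm E f)\<^sup>2"]) auto
  then show "edge_laplacian E f \<in> l2_cochains E"
    using edge_laplacian_one_cochain l2_cochains_iff by blast
  have "(cochain_norm E (edge_laplacian E f))\<^sup>2 \<le> ((1 + s)\<^sup>2 * cochain_norm E f)\<^sup>2"
    unfolding cochain_norm_square[OF edge_laplacian_one_cochain]
    by (rule infsum_le_finite_sums[OF summable edge_laplacian_energy[OF assms]])
  then show "cochain_norm E (edge_laplacian E f) \<le> (1 + s)\<^sup>2 * cochain_norm E f"
    by (rule power2_le_imp_le) (simp add: cochain_norm_nonneg)
qed

lemma edge_laplacian_bounded:
  "bounded_cochain_operator E
    (edge_laplacian E :: ('v \<times> 'v \<Rightarrow> 'k::real_normed_field) \<Rightarrow> 'v \<times> 'v \<Rightarrow> 'k)"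
  unfolding bounded_cochain_operator_def
proof (intro conjI ballI allI exI)
  fix f g :: "'v \<times> 'v \<Rightarrow> 'k" and c :: 'k
  show "edge_laplacian E (\<lambda>p. f p + g p) = (\<lambda>p. edge_laplacian E f p + edge_laplacian E g p)"
    by (auto simp: edge_laplacian_def d1_def delta1_def sum.distrib)
  show "edge_laplacian E (\<lambda>p. c * f p) = (\<lambda>p. c * edge_laplacian E f p)"
    by (auto simp: edge_laplacian_def d1_def delta1_def sum_distrib_left right_diff_distrib)
qed (fact edge_laplacian_l2 edge_laplacian_norm_le)+

section \<open>Lower bound\<close>

definition sphere :: "nat \<Rightarrow> 'v set" where
  "sphere n = {x \<in> V. level x = n}"

lemma sphere_0: "sphere 0 = {root}"
  using level_pos root_in_V by (force simp: sphere_def)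

lemma sphere_Suc: "sphere (Suc n) = (\<Union>x\<in>sphere n. children x)"
proof (intro equalityI subsetI)
  fix y assume y: "y \<in> sphere (Suc n)"
  then have "y \<in> V - {root}" by (auto simp: sphere_def)
  then show "y \<in> (\<Union>x\<in>sphere n. children x)"
    using y parent_in_V level_parent by (fastforce simp: sphere_def children_def)
next
  fix y assume "y \<in> (\<Union>x\<in>sphere n. children x)"
  then show "y \<in> sphere (Suc n)" using level_parent by (fastforce simp: sphere_def children_def)
qed

lemma finite_sphere: "finite (sphere n)"
proof (induction n)
  case 0
  show ?case by (simp add: sphere_0)
next
  case (Suc n)
  then show ?case unfolding sphere_Suc using finite_children by (auto simp: sphere_def)
qed

lemma card_sphere_Suc: "card (sphere (Suc n)) = (\<Sum>x\<in>sphere n. card (children x))"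
  unfolding sphere_Suc
  using finite_sphere[of n] finite_children
  by (intro card_UN_disjoint) (auto simp: sphere_def children_def)

lemma card_sphere: "card (sphere (Suc n)) = d * (d - 1) ^ n"
proof (induction n)
  case 0
  show ?case using card_sphere_Suc[of 0] card_children[OF root_in_V] by (simp add: sphere_0)
next
  case (Suc n)
  have "card (sphere (Suc (Suc n))) = (\<Sum>x\<in>sphere (Suc n). d - 1)"
    unfolding card_sphere_Suc[of "Suc n"]
    by (intro sum.cong refl) (auto simp: sphere_def card_children)
  then show ?case using Suc by simp
qed

text \<open>
  The growth \<open>(d - 1) ^ n\<close> of the spheres cancels the decay of the squares exactly, which is why
  the test cochains below are almost extremal.
\<close>
lemma sum_decay_over_spheres:
  assumes "finite I"
  shows "(\<Sum>x\<in>(\<Union>n\<in>I. sphere (Suc n)). ((- 1 / s) ^ level x)\<^sup>2) = real (card I) * (real d / s\<^sup>2)"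
proof -
  have "(\<Sum>x\<in>(\<Union>n\<in>I. sphere (Suc n)). ((- 1 / s) ^ level x)\<^sup>2)
      = (\<Sum>n\<in>I. \<Sum>x\<in>sphere (Suc n). ((- 1 / s) ^ level x)\<^sup>2)"
    using assms finite_sphere by (intro sum.UNION_disjoint) (auto simp: sphere_def)
  also have "\<dots> = (\<Sum>n\<in>I. real d / s\<^sup>2)"
  proof (rule sum.cong[OF refl])
    fix n
    have "(\<Sum>x\<in>sphere (Suc n). ((- 1 / s) ^ level x)\<^sup>2) = (\<Sum>x\<in>sphere (Suc n). (1 / s\<^sup>2) ^ Suc n)"
    proof (rule sum.cong[OF refl])
      fix x assume "x \<in> sphere (Suc n)"
      then have "((- 1 / s) ^ level x)\<^sup>2 = ((- 1 / s)\<^sup>2) ^ Suc n"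
        by (simp only: sphere_def mem_Collect_eq power_mult[symmetric] mult.commute)
      also have "(- 1 / s)\<^sup>2 = 1 / s\<^sup>2" by (simp only: power_divide) simp
      finally show "((- 1 / s) ^ level x)\<^sup>2 = (1 / s\<^sup>2) ^ Suc n" .
    qed
    also have "\<dots> = real d * (s\<^sup>2) ^ n * (1 / s\<^sup>2) ^ Suc n"
      using card_sphere[of n] degree s_square by (simp add: of_nat_diff)
    also have "\<dots> = real d / s\<^sup>2"
      using s_gt_1 by (simp add: power_one_over field_simps)
    finally show "(\<Sum>x\<in>sphere (Suc n). ((- 1 / s) ^ level x)\<^sup>2) = real d / s\<^sup>2" .
  qed
  finally show ?thesis by simp
qed

text \<open>
  The formal eigenvector cut off above level \<open>N\<close>. Writing it as a difference makes antisymmetry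
  evident; at most one of the two terms is nonzero.
\<close>
definition radial_cochain :: "nat \<Rightarrow> 'v \<times> 'v \<Rightarrow> 'k::real_normed_field" where
  "radial_cochain N = (\<lambda>(x, y).
    (if y \<in> V - {root} \<and> x = parent y \<and> level y \<le> N then of_real ((- 1 / s) ^ level y) else 0) -
    (if x \<in> V - {root} \<and> y = parent x \<and> level x \<le> N then of_real ((- 1 / s) ^ level x) else 0))"

lemma radial_cochain_one_cochain:
  "one_cochain E (radial_cochain N :: 'v \<times> 'v \<Rightarrow> 'k::real_normed_field)"
proof -
  let ?f = "radial_cochain N :: 'v \<times> 'v \<Rightarrow> 'k"
  have antisym: "?f (y, x) = - ?f (x, y)" for x y
    by (simp only: radial_cochain_def prod.case minus_diff_eq)
  have zero: "?f (x, y) = 0" if "{x, y} \<notin> E" for x y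
  proof -
    have "\<not> (y \<in> V - {root} \<and> x = parent y)" using that parent_edge by blast
    moreover have "\<not> (x \<in> V - {root} \<and> y = parent x)"
      using that parent_edge by (metis insert_commute)
    ultimately show ?thesis unfolding radial_cochain_def prod.case
      by (subst if_not_P, blast, subst if_not_P, blast, simp)
  qed
  have "?f p = 0" if "p \<notin> oriented_edges E" for p
    using that by (cases p) (simp add: oriented_edges_def zero)
  then show ?thesis unfolding one_cochain_def using antisym by blast
qed

lemma radial_cochain_parent:
  assumes x: "x \<in> V - {root}"
  shows "radial_cochain N (parent x, x) = of_real (if level x \<le> N then (- 1 / s) ^ level x else 0)"
proof -
  have "parent (parent x) \<noteq> x" if "parent x \<in> V - {root}"
    using level_parent[OF x] level_parent[OF that] by (metis lessI less_SucI less_irrefl)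
  then show ?thesis using x unfolding radial_cochain_def by auto
qed

text \<open>
  The \<open>s\<^sup>2\<close> children contribute \<open>- s\<^sup>2 (- 1 / s) ^ Suc (level x) = s (- 1 / s) ^ level x\<close>, in phase
  with the parent edge. The bound on the level is strict because the children must not be cut off.
\<close>
lemma delta1_radial_cochain:
  assumes x: "x \<in> V - {root}" and "level x < N"
  shows "delta1 E (radial_cochain N) x = (of_real ((1 + s) * (- 1 / s) ^ level x) :: 'k::real_normed_field)"
proof -
  have "(\<Sum>y\<in>children x. radial_cochain N (x, y) :: 'k)
      = (\<Sum>y\<in>children x. of_real ((- 1 / s) ^ Suc (level x)))"
  proof (rule sum.cong[OF refl])
    fix y assume "y \<in> children x"
    then have y: "y \<in> V - {root}" "parent y = x" by (auto simp: children_def)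
    then show "radial_cochain N (x, y) = of_real ((- 1 / s) ^ Suc (level x))"
      using radial_cochain_parent[OF y(1), of N] level_parent[OF y(1)] assms(2) by auto
  qed
  also have "\<dots> = of_real (s\<^sup>2 * (- 1 / s) ^ Suc (level x))"
    using card_children[of x] x s_square degree by (simp add: of_nat_diff)
  also have eq: "s\<^sup>2 * (- 1 / s) ^ Suc (level x) = - s * (- 1 / s) ^ level x"
    using s_gt_1 by (simp add: power2_eq_square)
  finally have ch: "(\<Sum>y\<in>children x. radial_cochain N (x, y))
      = (of_real (- s * (- 1 / s) ^ level x) :: 'k)" .
  have "delta1 E (radial_cochain N) x
      = (radial_cochain N (parent x, x) - (\<Sum>y\<in>children x. radial_cochain N (x, y)) :: 'k)"
    using delta1_eq[OF radial_cochain_one_cochain, of x N] x by simp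
  also have "\<dots> = of_real ((- 1 / s) ^ level x) - of_real (- s * (- 1 / s) ^ level x)"
    unfolding ch using radial_cochain_parent[OF x, of N] assms(2) by simp
  also have "\<dots> = of_real ((1 + s) * (- 1 / s) ^ level x)"
    unfolding of_real_diff[symmetric] by (simp only: distrib_right) simp
  finally show ?thesis .
qed

text \<open>
  Level \<open>1\<close> is excluded since the divergence at the root, which has no parent edge, does not follow
  the eigenvector pattern.
\<close>
lemma edge_laplacian_radial_cochain:
  assumes x: "x \<in> V - {root}" and lev: "2 \<le> level x" "level x < N"
  shows "edge_laplacian E (radial_cochain N) (parent x, x)
    = (of_real ((1 + s)\<^sup>2 * (- 1 / s) ^ level x) :: 'k::real_normed_field)"
proof -
  have l: "Suc (level (parent x)) = level x" by (rule level_parent[OF x])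
  have p: "parent x \<in> V - {root}" using parent_in_V[OF x] l lev(1) by auto
  have "- s * (- 1 / s) = 1" using s_gt_1 by simp
  then have prev: "(- 1 / s) ^ level (parent x) = - s * (- 1 / s) ^ level x"
    unfolding l[symmetric] power_Suc mult.assoc[symmetric] by simp
  have factor: "(1 + a) * b - (1 + a) * (- a * b) = (1 + a)\<^sup>2 * b" for a b :: real
    by (simp add: power2_eq_square algebra_simps)
  have "edge_laplacian E (radial_cochain N) (parent x, x)
      = (of_real ((1 + s) * (- 1 / s) ^ level x) - of_real ((1 + s) * (- 1 / s) ^ level (parent x)) :: 'k)"
    using l lev(2)
    by (simp only: edge_laplacian_parent[OF x] delta1_radial_cochain[OF x lev(2)]
        delta1_radial_cochain[OF p, of N])
  also have "\<dots> = of_real ((1 + s)\<^sup>2 * (- 1 / s) ^ level x)"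
    unfolding prev of_real_diff[symmetric] by (rule arg_cong[where f = of_real], rule factor)
  finally show ?thesis .
qed

lemma
  shows radial_cochain_l2: "radial_cochain N \<in> (l2_cochains E :: ('v \<times> 'v \<Rightarrow> 'k::real_normed_field) set)"
    and radial_cochain_norm:
      "(cochain_norm E (radial_cochain N :: 'v \<times> 'v \<Rightarrow> 'k))\<^sup>2 = real N * (real d / s\<^sup>2)"
proof -
  let ?f = "radial_cochain N :: 'v \<times> 'v \<Rightarrow> 'k"
  let ?B = "\<Union>n\<in>{..<N}. sphere (Suc n)"
  have B: "x \<in> ?B \<longleftrightarrow> x \<in> V - {root} \<and> level x \<le> N" for x
  proof
    assume "x \<in> ?B"
    then show "x \<in> V - {root} \<and> level x \<le> N" by (auto simp: sphere_def)
  next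
    assume x: "x \<in> V - {root} \<and> level x \<le> N"
    then obtain n where "level x = Suc n" using level_pos[of x] by (cases "level x") auto
    then show "x \<in> ?B" using x by (auto simp: sphere_def intro!: bexI[of _ n])
  qed
  have fin: "finite ?B" using finite_sphere by auto
  have 0: "up ?f x = 0" if "x \<in> V - {root} - ?B" for x
    using that B[of x] by (simp add: radial_cochain_parent)
  have sub: "?B \<subseteq> V - {root}" using B by blast
  have "(up ?f has_sum (\<Sum>x\<in>?B. up ?f x)) (V - {root})"
    by (rule has_sum_finite_neutralI[OF fin sub 0 refl])
  moreover have "(\<Sum>x\<in>?B. up ?f x) = real N * (real d / s\<^sup>2)"
  proof -
    have "(\<Sum>x\<in>?B. up ?f x) = (\<Sum>x\<in>?B. ((- 1 / s) ^ level x)\<^sup>2)"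
    proof (rule sum.cong[OF refl])
      fix x assume "x \<in> ?B"
      then have "?f (parent x, x) = of_real ((- 1 / s) ^ level x)"
        using B[of x] radial_cochain_parent[of x N] by simp
      then show "up ?f x = ((- 1 / s) ^ level x)\<^sup>2" by (simp only: norm_of_real power2_abs)
    qed
    then show ?thesis using sum_decay_over_spheres[of "{..<N}"] by simp
  qed
  ultimately have sum: "(up ?f has_sum real N * (real d / s\<^sup>2)) (V - {root})" by simp
  show "?f \<in> l2_cochains E"
    using radial_cochain_one_cochain has_sum_imp_summable[OF sum] l2_cochains_iff by blast
  show "(cochain_norm E ?f)\<^sup>2 = real N * (real d / s\<^sup>2)"
    unfolding cochain_norm_square[OF radial_cochain_one_cochain] by (rule infsumI[OF sum])
qed

lemma edge_laplacian_radial_norm_ge: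
  fixes m
  defines "f \<equiv> (radial_cochain (m + 2) :: 'v \<times> 'v \<Rightarrow> 'k::real_normed_field)"
  shows "((1 + s)\<^sup>2)\<^sup>2 * (real m * (real d / s\<^sup>2)) \<le> (cochain_norm E (edge_laplacian E f))\<^sup>2"
proof -
  let ?B = "\<Union>n\<in>{1..<Suc m}. sphere (Suc n)"
  have B: "x \<in> V - {root} \<and> 2 \<le> level x \<and> level x < m + 2" if "x \<in> ?B" for x
    using that by (auto simp: sphere_def)
  have "((1 + s)\<^sup>2)\<^sup>2 * (real m * (real d / s\<^sup>2)) = (\<Sum>x\<in>?B. ((1 + s)\<^sup>2)\<^sup>2 * ((- 1 / s) ^ level x)\<^sup>2)"
    using sum_decay_over_spheres[of "{1..<Suc m}"] by (simp only: sum_distrib_left[symmetric]) simp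
  also have "\<dots> = (\<Sum>x\<in>?B. up (edge_laplacian E f) x)"
  proof (rule sum.cong[OF refl])
    fix x assume "x \<in> ?B"
    then have "edge_laplacian E f (parent x, x) = of_real ((1 + s)\<^sup>2 * (- 1 / s) ^ level x)"
      unfolding f_def using B edge_laplacian_radial_cochain by blast
    then show "((1 + s)\<^sup>2)\<^sup>2 * ((- 1 / s) ^ level x)\<^sup>2 = up (edge_laplacian E f) x"
      by (simp only: norm_of_real power2_abs power_mult_distrib)
  qed
  also have "\<dots> \<le> (\<Sum>\<^sub>\<infinity>x\<in>V - {root}. up (edge_laplacian E f) x)"
    using edge_laplacian_l2[OF radial_cochain_l2] B finite_sphere
    by (intro finite_sum_le_infsum) (auto simp: l2_cochains_iff f_def)
  also have "\<dots> = (cochain_norm E (edge_laplacian E f))\<^sup>2"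
    by (rule cochain_norm_square[OF edge_laplacian_one_cochain, symmetric])
  finally show ?thesis .
qed

lemma edge_laplacian_onorm:
  "cochain_onorm E (edge_laplacian E :: ('v \<times> 'v \<Rightarrow> 'k::real_normed_field) \<Rightarrow> 'v \<times> 'v \<Rightarrow> 'k)
    = (1 + s)\<^sup>2"
proof (rule antisym)
  let ?T = "edge_laplacian E :: ('v \<times> 'v \<Rightarrow> 'k) \<Rightarrow> 'v \<times> 'v \<Rightarrow> 'k"
  have ratio: "cochain_norm E (?T f) / cochain_norm E f \<le> (1 + s)\<^sup>2" if "f \<in> l2_cochains E" for f
    using edge_laplacian_norm_le[OF that] cochain_norm_nonneg[of f]
    by (cases "cochain_norm E f = 0") (auto simp: divide_le_eq)
  then show "cochain_onorm E ?T \<le> (1 + s)\<^sup>2"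
    unfolding cochain_onorm_def using radial_cochain_l2 by (intro cSUP_least) auto
  have "(1 + s)\<^sup>2 * sqrt (real m / real (m + 2)) \<le> cochain_onorm E ?T" for m
  proof -
    let ?f = "radial_cochain (m + 2) :: 'v \<times> 'v \<Rightarrow> 'k"
    have pos: "real d / s\<^sup>2 > 0" using degree s_gt_1 by (simp only: zero_less_divide_iff) simp
    have quotient: "c * sqrt (a / b) = sqrt (c\<^sup>2 * (a * e)) / sqrt (b * e)"
      if "c \<ge> 0" "e > 0" for a b c e :: real
      using that by (simp add: real_sqrt_mult real_sqrt_divide)
    have "(1 + s)\<^sup>2 * sqrt (real m / real (m + 2))
        = sqrt (((1 + s)\<^sup>2)\<^sup>2 * (real m * (real d / s\<^sup>2))) / sqrt (real (m + 2) * (real d / s\<^sup>2))"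
      by (rule quotient) (use pos in auto)
    also have "\<dots> \<le> cochain_norm E (?T ?f) / sqrt (real (m + 2) * (real d / s\<^sup>2))"
      by (intro divide_right_mono real_le_lsqrt cochain_norm_nonneg edge_laplacian_radial_norm_ge)
        (use pos in auto)
    also have "sqrt (real (m + 2) * (real d / s\<^sup>2)) = cochain_norm E ?f"
      by (intro real_sqrt_unique radial_cochain_norm cochain_norm_nonneg)
    also have "cochain_norm E (?T ?f) / cochain_norm E ?f \<le> cochain_onorm E ?T"
      unfolding cochain_onorm_def
      by (intro cSUP_upper radial_cochain_l2 bdd_aboveI2[where M = "(1 + s)\<^sup>2"] ratio)
    finally show ?thesis .
  qed
  moreover have "(\<lambda>m. (1 + s)\<^sup>2 * sqrt (real m / real (m + 2))) \<longlonglongrightarrow> (1 + s)\<^sup>2 * 1"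
    by (intro tendsto_mult tendsto_const) real_asymp
  ultimately show "(1 + s)\<^sup>2 \<le> cochain_onorm E ?T"
    using LIMSEQ_le_const2 by fastforce
qed

end

theorem mainTheorem7:
  fixes d :: nat and V :: "'v set" and E :: "'v set set"
  defines "\<Delta> \<equiv> (edge_laplacian E ::
      ('v \<times> 'v \<Rightarrow> 'k::{real_normed_field, real_inner}) \<Rightarrow> 'v \<times> 'v \<Rightarrow> 'k)"
  assumes "d \<ge> 3"
    and "tree_graph V E"
    and "regular_graph d V E"
  shows "bipartite_graph V E \<and>
    bounded_cochain_operator E \<Delta> \<and>
    cochain_onorm E \<Delta> = real d + 2 * sqrt (real d - 1) \<and>
    real d + 2 * sqrt (real d - 1) < 2 * real d"
proof -
  interpret regular_tree d V E by standard (fact assms)+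
  have "0 < (s - 1)\<^sup>2" using s_gt_1 by simp
  then have "2 * s < real d" using s_square by (simp add: power2_diff)
  then show ?thesis
    unfolding \<Delta>_def
    using bipartite edge_laplacian_bounded edge_laplacian_onorm norm_bound_eq
    by (simp add: s_def)
qed

end
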